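(* Let $\widetilde{\mathbf{u}} \in \mathbb{R}^{m+n}$ be a solution of the deflated system $\boldsymbol{\mathcal{P}} \mathbf{K} \widetilde{\mathbf{u}} = \boldsymbol{\mathcal{P}} \mathbf{f}$. Then the solution of the linear system $\mathbf{K}\begin{bmatrix}\mathbf{x}\\ \mathbf{y}\end{bmatrix} = \mathbf{f}$ is given by $$\mathbf{u} = \mathbf{Z}_k \left( \mathbf{Z}_k^\top \mathbf{K}\mathbf{Z}_k \right)^{-1} \mathbf{Z}_k^\top \mathbf{f} + \boldsymbol{\mathcal{P}}^\top \widetilde{\mathbf{u}}, \qquad \mathbf{Z}_k = \begin{bmatrix} \widetilde{\mathbf{U}}_k & \mathbf{0} \\ \mathbf{0} & \widetilde{\mathbf{V}}_k \end{bmatrix}.$$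
   Context: All matrices and vectors are real. Let $\mathbf{M} \in \mathbb{R}^{m \times m}$ and $\mathbf{N} \in \mathbb{R}^{n \times n}$ be symmetric positive definite, $\mathbf{A} \in \mathbb{R}^{m\times n}$ nonzero, $\mathbf{b} \in \mathbb{R}^m$ and $\mathbf{c} \in \mathbb{R}^n$ nonzero. Put $$\mathbf{K} = \begin{bmatrix} \mathbf{M} & \mathbf{A} \\ \mathbf{A}^\top & -\mathbf{N} \end{bmatrix}, \qquad \mathbf{f} = \begin{bmatrix} \mathbf{b} \\ \mathbf{c} \end{bmatrix}.$$ ($\mathbf{K}$ is nonsingular.) Elliptic singular value decomposition (ESVD) of $\mathbf{A}$: $\mathbf{A} = \mathbf{M} \widetilde{\mathbf{U}} \boldsymbol{\Sigma} \widetilde{\mathbf{V}}^\top \mathbf{N}$, where $\widetilde{\mathbf{U}} \in \mathbb{R}^{m \times m}$ and $\widetilde{\mathbf{V}} \in \mathbb{R}^{n \times n}$ satisfy $\widetilde{\mathbf{U}}^\top \mathbf{M} \widetilde{\mathbf{U}} = \mathbf{I}_m$ and $\widetilde{\mathbf{V}}^\top \mathbf{N} \widetilde{\mathbf{V}} = \mathbf{I}_n$, and $\boldsymbol{\Sigma} \in \mathbb{R}^{m \times n}$ is diagonal with nonnegative diagonal entries $\sigma_1 \ge \sigma_2 \ge \cdots \ge \sigma_{\min\{m,n\}} \ge 0$ in nonincreasing order. Fix such an ESVD and an integer $k$ with $1 \le k \le \min\{m,n\}$. Let $\widetilde{\mathbf{U}}_k$ and $\widetilde{\mathbf{V}}_k$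 be the matrices consisting of the first $k$ columns of $\widetilde{\mathbf{U}}$ and $\widetilde{\mathbf{V}}$, respectively. Define $$\mathbf{P} = \mathbf{I} - \mathbf{M} \widetilde{\mathbf{U}}_k \widetilde{\mathbf{U}}_k^\top, \qquad \mathbf{Q} = \mathbf{I} - \widetilde{\mathbf{V}}_k \widetilde{\mathbf{V}}_k^\top \mathbf{N}, \qquad \boldsymbol{\mathcal{P}} = \begin{bmatrix} \mathbf{P} & \mathbf{0} \\ \mathbf{0} & \mathbf{Q}^\top \end{bmatrix}.$$ *)

theory Defs
  imports "Jordan_Normal_Form.Gauss_Jordan_Elimination"
begin

definition sym_pos_def :: "nat \<Rightarrow> real mat \<Rightarrow> bool" where
  "sym_pos_def n M \<longleftrightarrow> M \<in> carrier_mat n n \<and> M\<^sup>T = M \<and>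
     (\<forall>v \<in> carrier_vec n. v \<noteq> 0\<^sub>v n \<longrightarrow> v \<bullet> (M *\<^sub>v v) > 0)"

text \<open>Indices are 0-based: \<open>S $$ (i, i)\<close> is the (i+1)-st elliptic singular value.\<close>

definition is_ESVD ::
  "nat \<Rightarrow> nat \<Rightarrow> real mat \<Rightarrow> real mat \<Rightarrow> real mat \<Rightarrow> real mat \<Rightarrow> real mat \<Rightarrow> real mat \<Rightarrow> bool" where
  "is_ESVD m n M N A U S V \<longleftrightarrow>
     U \<in> carrier_mat m m \<and> S \<in> carrier_mat m n \<and> V \<in> carrier_mat n n \<and>
     A = M * U * S * V\<^sup>T * N \<and>
     U\<^sup>T * M * U = 1\<^sub>m m \<and> V\<^sup>T * N * V = 1\<^sub>m n \<and>
     diagonal_mat S \<and>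
     (\<forall>i < min m n. 0 \<le> S $$ (i, i)) \<and>
     (\<forall>i j. i \<le> j \<longrightarrow> j < min m n \<longrightarrow> S $$ (j, j) \<le> S $$ (i, i))"

definition saddle_mat :: "real mat \<Rightarrow> real mat \<Rightarrow> real mat \<Rightarrow> real mat" where
  "saddle_mat M N A = four_block_mat M A A\<^sup>T (- N)"

definition first_cols :: "nat \<Rightarrow> real mat \<Rightarrow> real mat" where
  "first_cols k X = mat_of_cols (dim_row X) (take k (cols X))"

definition P_mat :: "nat \<Rightarrow> real mat \<Rightarrow> real mat \<Rightarrow> real mat" where
  "P_mat k M U = 1\<^sub>m (dim_row M) - M * first_cols k U * (first_cols k U)\<^sup>T"

definition Q_mat :: "nat \<Rightarrow> real mat \<Rightarrow> real mat \<Rightarrow> real mat" where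
  "Q_mat k N V = 1\<^sub>m (dim_row N) - first_cols k V * (first_cols k V)\<^sup>T * N"

definition deflation_mat :: "nat \<Rightarrow> real mat \<Rightarrow> real mat \<Rightarrow> real mat \<Rightarrow> real mat \<Rightarrow> real mat" where
  "deflation_mat k M N U V =
     four_block_mat (P_mat k M U) (0\<^sub>m (dim_row M) (dim_row N))
       (0\<^sub>m (dim_row N) (dim_row M)) (Q_mat k N V)\<^sup>T"

definition Z_mat :: "nat \<Rightarrow> real mat \<Rightarrow> real mat \<Rightarrow> real mat" where
  "Z_mat k U V =
     four_block_mat (first_cols k U) (0\<^sub>m (dim_row U) k)
       (0\<^sub>m (dim_row V) k) (first_cols k V)"

text \<open>The value of this constant is meaningful only for invertible matrices.\<close>

definition inv_mat :: "real mat \<Rightarrow> real mat" where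
  "inv_mat X = the (mat_inverse X)"

end

theory Submission
  imports Defs "Jordan_Normal_Form.Determinant"
begin

text \<open>
  Put \<open>W = diag(M U\<^sub>k, N V\<^sub>k)\<close>. The ESVD gives \<open>K Z = W E\<close>, where \<open>E\<close> is the saddle point matrix
  with identity diagonal blocks and off-diagonal block the leading \<open>k \<times> k\<close> block of \<open>\<Sigma>\<close>, and
  \<open>Z\<^sup>T W = I\<close>; hence \<open>Z\<^sup>T K Z = E\<close>. The deflation matrix is \<open>D = I - W Z\<^sup>T\<close>, so
  \<open>K Z E\<inverse> Z\<^sup>T = W Z\<^sup>T = I - D\<close>, and \<open>D K = K - W E W\<^sup>T = K D\<^sup>T\<close> by symmetry of \<open>K\<close>.
  Thus \<open>K u = (I - D) f + D K v = f\<close> for a deflated solution \<open>v\<close>. Both \<open>K\<close> and \<open>E\<close> are invertible since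
  \<open>K (x, y) = 0\<close> forces \<open>x\<^sup>T M x + y\<^sup>T N y = 0\<close>.
\<close>

text \<open>Side conditions are equations between dimensions, so the simplifier can discharge them
  without guessing the carrier parameters; the next two lemmas follow the same pattern.\<close>

lemma assoc_mult_mat_dim:
  assumes "dim_col A = dim_row B" "dim_col B = dim_row C"
  shows "A * B * C = A * (B * (C :: 'a :: semiring_0 mat))"
  using assms by (intro assoc_mult_mat) auto

lemma transpose_mult_dim:
  assumes "dim_col A = dim_row B"
  shows "(A * B)\<^sup>T = B\<^sup>T * (A :: 'a :: comm_semiring_0 mat)\<^sup>T"
  using assms by (intro transpose_mult) auto

lemma assoc_mult_mat_vec_dim:
  assumes "dim_col A = dim_row B" "dim_col B = dim_vec v"
  shows "(A * B) *\<^sub>v v = A *\<^sub>v (B *\<^sub>v (v :: 'a :: semiring_0 vec))"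
  using assms by (intro assoc_mult_mat_vec) auto

text \<open>Lets the small matrix \<open>E\<close> of the main proof be treated as a saddle point
  matrix, so that symmetry and invertibility come from the same lemmas as for
  \<open>K\<close>.\<close>

lemma sym_pos_def_one: "sym_pos_def k (1\<^sub>m k)"
proof -
  have "v \<bullet> (1\<^sub>m k *\<^sub>v v) > 0" if "v \<in> carrier_vec k" "v \<noteq> 0\<^sub>v k" for v :: "real vec"
  proof -
    \<comment> \<open>Conjugation is trivial on real vectors, so positivity of
      \<open>v \<bullet>c v\<close> is positivity of \<open>v \<bullet> v\<close>.\<close>
    have "conjugate v = v" by (intro eq_vecI) auto
    then show ?thesis using that conjugate_square_greater_0_vec[OF that(1)] by simp
  qed
  then show ?thesis by (simp add: sym_pos_def_def)
qed

section \<open>Saddle point matrices: kernel, invertibility and symmetry\<close>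

lemma saddle_mat_carrier:
  assumes "M \<in> carrier_mat m m" "N \<in> carrier_mat n n"
  shows "saddle_mat M N A \<in> carrier_mat (m + n) (m + n)"
  using assms unfolding saddle_mat_def by auto

lemma saddle_mat_mult_vec:
  assumes M: "M \<in> carrier_mat m m" and N: "N \<in> carrier_mat n n" and A: "A \<in> carrier_mat m n"
    and x: "x \<in> carrier_vec m" and y: "y \<in> carrier_vec n"
  shows "saddle_mat M N A *\<^sub>v (x @\<^sub>v y) =
    (M *\<^sub>v x + A *\<^sub>v y) @\<^sub>v (A\<^sup>T *\<^sub>v x + (- N) *\<^sub>v y)"
  unfolding saddle_mat_def
  by (rule four_block_mat_mult_vec[OF M A _ _ x y]) (use A N in auto)

text \<open>Pair the first block row with \<open>x\<close> and the second with \<open>y\<close>. The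
  cross terms agree, so subtracting leaves a sum of two nonnegative quadratic forms equal to
  zero.\<close>

lemma saddle_mat_kernel:
  assumes "sym_pos_def m M" "sym_pos_def n N" and A: "A \<in> carrier_mat m n"
    and x: "x \<in> carrier_vec m" and y: "y \<in> carrier_vec n"
    and eq: "saddle_mat M N A *\<^sub>v (x @\<^sub>v y) = 0\<^sub>v (m + n)"
  shows "x = 0\<^sub>v m \<and> y = 0\<^sub>v n"
proof -
  have M: "M \<in> carrier_mat m m" and N: "N \<in> carrier_mat n n"
    using assms by (auto simp: sym_pos_def_def)
  have "(M *\<^sub>v x + A *\<^sub>v y) @\<^sub>v (A\<^sup>T *\<^sub>v x + (- N) *\<^sub>v y) = 0\<^sub>v m @\<^sub>v 0\<^sub>v n"
    using eq saddle_mat_mult_vec[OF M N A x y] by auto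
  then have e1: "M *\<^sub>v x + A *\<^sub>v y = 0\<^sub>v m" and e2: "A\<^sup>T *\<^sub>v x + (- N) *\<^sub>v y = 0\<^sub>v n"
    using append_vec_eq[of "M *\<^sub>v x + A *\<^sub>v y" m "0\<^sub>v m"] M A x y by auto
  have "x \<bullet> (M *\<^sub>v x) + x \<bullet> (A *\<^sub>v y) = 0"
    using arg_cong[OF e1, of "\<lambda>v. x \<bullet> v"] x y M A
    by (simp add: scalar_prod_add_distrib[where n = m])
  moreover have "y \<bullet> (A\<^sup>T *\<^sub>v x) - y \<bullet> (N *\<^sub>v y) = 0"
    using arg_cong[OF e2, of "\<lambda>v. y \<bullet> v"] x y N A
    by (simp add: scalar_prod_add_distrib[where n = n] uminus_mult_mat_vec[where v = y])
  moreover have "y \<bullet> (A\<^sup>T *\<^sub>v x) = x \<bullet> (A *\<^sub>v y)"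
    using transpose_vec_mult_scalar[OF A y x] comm_scalar_prod[of y n "A\<^sup>T *\<^sub>v x"] x y A by simp
  ultimately have sum: "x \<bullet> (M *\<^sub>v x) + y \<bullet> (N *\<^sub>v y) = 0" by simp
  have "x \<bullet> (M *\<^sub>v x) > 0 \<or> x = 0\<^sub>v m" "y \<bullet> (N *\<^sub>v y) > 0 \<or> y = 0\<^sub>v n"
    using assms by (auto simp: sym_pos_def_def)
  with sum x y M N show ?thesis by (auto simp: scalar_prod_left_zero[where n = m])
qed

lemma saddle_mat_det_nonzero:
  assumes "sym_pos_def m M" "sym_pos_def n N" and A: "A \<in> carrier_mat m n"
  shows "det (saddle_mat M N A) \<noteq> 0"
proof
  assume "det (saddle_mat M N A) = 0"
  moreover have K: "saddle_mat M N A \<in> carrier_mat (m + n) (m + n)"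
    using assms by (auto simp: sym_pos_def_def intro: saddle_mat_carrier)
  ultimately obtain v where v: "v \<in> carrier_vec (m + n)" "v \<noteq> 0\<^sub>v (m + n)"
    and eq: "saddle_mat M N A *\<^sub>v v = 0\<^sub>v (m + n)"
    using det_0_iff_vec_prod_zero by blast
  have "v = vec_first v m @\<^sub>v vec_last v n" using v(1) by simp
  moreover from this have "vec_first v m = 0\<^sub>v m \<and> vec_last v n = 0\<^sub>v n"
    using saddle_mat_kernel[OF assms, of "vec_first v m" "vec_last v n"] eq by auto
  ultimately show False using v(2) by auto
qed

text \<open>A nonzero determinant makes \<open>X\<close> a unit of the matrix ring, which excludes
  the result \<open>None\<close> of \<open>mat_inverse\<close> and gives \<open>the\<close> its
  intended value.\<close>

lemma inv_mat_correct:
  assumes X: "X \<in> carrier_mat n n" and "det X \<noteq> 0"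
  shows "inv_mat X \<in> carrier_mat n n" "X * inv_mat X = 1\<^sub>m n" "inv_mat X * X = 1\<^sub>m n"
    "invertible_mat X"
proof -
  have "X \<in> Units (ring_mat TYPE(real) n n)"
    using det_non_zero_imp_unit[OF assms, of n] .
  then obtain B where B: "mat_inverse X = Some B"
    using mat_inverse(1)[OF X, of n] by (cases "mat_inverse X") auto
  from mat_inverse(2)[OF X B]
  show 1: "inv_mat X \<in> carrier_mat n n" "X * inv_mat X = 1\<^sub>m n" "inv_mat X * X = 1\<^sub>m n"
    by (auto simp: inv_mat_def B)
  then show "invertible_mat X"
    using X unfolding invertible_mat_def inverts_mat_def by auto
qed

lemma transpose_saddle_mat:
  assumes "sym_pos_def m M" "sym_pos_def n N" "A \<in> carrier_mat m n"
  shows "(saddle_mat M N A)\<^sup>T = saddle_mat M N A"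
proof -
  have M: "M \<in> carrier_mat m m" "M\<^sup>T = M" and N: "N \<in> carrier_mat n n" "N\<^sup>T = N"
    using assms by (auto simp: sym_pos_def_def)
  have "(- N)\<^sup>T = - N" using N by (simp add: transpose_uminus)
  then show ?thesis
    unfolding saddle_mat_def
    using transpose_four_block_mat[OF M(1) assms(3), of "A\<^sup>T" n "- N"] M N assms(3) by simp
qed

section \<open>Deflation without block structure\<close>

text \<open>The coarse part of the candidate is mapped by \<open>K\<close> to
  \<open>(1\<^sub>m d - D) *\<^sub>v f\<close>. The other part is mapped to
  \<open>D *\<^sub>v f\<close>, because \<open>D * K = K * D\<^sup>T\<close>.\<close>

lemma deflated_solution:
  fixes K :: "'a :: comm_ring_1 mat"
  assumes K: "K \<in> carrier_mat d d" "K\<^sup>T = K"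
    and Z: "Z \<in> carrier_mat d r" and W: "W \<in> carrier_mat d r"
    and E: "E \<in> carrier_mat r r" "E\<^sup>T = E" and F: "F \<in> carrier_mat r r" "E * F = 1\<^sub>m r"
    and KZ: "K * Z = W * E"
    and D: "D = 1\<^sub>m d - W * Z\<^sup>T"
    and f: "f \<in> carrier_vec d" and u: "u \<in> carrier_vec d"
    and eq: "(D * K) *\<^sub>v u = D *\<^sub>v f"
  shows "K *\<^sub>v ((Z * F * Z\<^sup>T) *\<^sub>v f + D\<^sup>T *\<^sub>v u) = f"
proof -
  have Zt: "Z\<^sup>T \<in> carrier_mat r d" and Wt: "W\<^sup>T \<in> carrier_mat r d"
    and WZ: "W * Z\<^sup>T \<in> carrier_mat d d" and Dc: "D \<in> carrier_mat d d"
    using Z W D by auto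
  have "K * (Z * F * Z\<^sup>T) = K * Z * F * Z\<^sup>T"
    using K Z F Zt by (simp add: assoc_mult_mat_dim)
  also have "\<dots> = W * (E * F) * Z\<^sup>T"
    using W E F unfolding KZ by (simp add: assoc_mult_mat_dim)
  also have "\<dots> = W * Z\<^sup>T" using W F by simp
  finally have coarse: "K * (Z * F * Z\<^sup>T) = W * Z\<^sup>T" .
  \<comment> \<open>The transpose of \<open>K * Z = W * E\<close>, by symmetry of \<open>K\<close>
    and \<open>E\<close>.\<close>
  have ZK: "Z\<^sup>T * K = E * W\<^sup>T"
    using arg_cong[OF KZ, of transpose_mat] transpose_mult[OF K(1) Z] transpose_mult[OF W E(1)]
    by (simp add: K E)
  \<comment> \<open>The projection is moved across \<open>K\<close> through the common value
    \<open>W * E * W\<^sup>T\<close>.\<close>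
  have "W * Z\<^sup>T * K = W * (E * W\<^sup>T)"
    using assoc_mult_mat[OF W Zt K(1)] ZK by simp
  also have "W * (E * W\<^sup>T) = K * Z * W\<^sup>T"
    using assoc_mult_mat[OF W E(1) Wt] KZ by simp
  also have "K * Z * W\<^sup>T = K * (Z * W\<^sup>T)"
    using assoc_mult_mat[OF K(1) Z Wt] .
  finally have WZK: "W * Z\<^sup>T * K = K * (Z * W\<^sup>T)" .
  have Dt: "D\<^sup>T = 1\<^sub>m d - Z * W\<^sup>T"
    unfolding D using transpose_minus[of "1\<^sub>m d" d d "W * Z\<^sup>T"] WZ transpose_mult[OF W Zt] by simp
  have "D * K = 1\<^sub>m d * K - W * Z\<^sup>T * K"
    unfolding D using one_carrier_mat WZ K(1) by (rule minus_mult_distrib_mat)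
  also have "\<dots> = K * 1\<^sub>m d - K * (Z * W\<^sup>T)"
    unfolding WZK using K by simp
  also have "\<dots> = K * D\<^sup>T"
    unfolding Dt using mult_minus_distrib_mat[OF K(1) one_carrier_mat, of "Z * W\<^sup>T"] Z Wt by simp
  finally have DK: "D * K = K * D\<^sup>T" .
  have "K *\<^sub>v ((Z * F * Z\<^sup>T) *\<^sub>v f + D\<^sup>T *\<^sub>v u) = (W * Z\<^sup>T) *\<^sub>v f + (K * D\<^sup>T) *\<^sub>v u"
    unfolding coarse[symmetric] using K Z F Zt Dc f u
    by (subst mult_add_distrib_mat_vec[where nc = d]) (auto simp: assoc_mult_mat_vec_dim)
  also have "\<dots> = (W * Z\<^sup>T) *\<^sub>v f + D *\<^sub>v f" using eq DK by simp
  also have "\<dots> = (W * Z\<^sup>T + D) *\<^sub>v f"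
    using add_mult_distrib_mat_vec[OF WZ Dc f] by simp
  also have "W * Z\<^sup>T + D = 1\<^sub>m d"
  proof -
    have "X + (1\<^sub>m d - X) = 1\<^sub>m d" if "X \<in> carrier_mat d d" for X :: "'a mat"
      using that by (intro eq_matI) auto
    then show ?thesis unfolding D using WZ .
  qed
  finally show ?thesis using f by simp
qed

section \<open>The ESVD and its first \<open>k\<close> columns\<close>

text \<open>Transposition exchanges the roles of \<open>M\<close>, \<open>U\<close> and
  \<open>N\<close>, \<open>V\<close>. Hence any formula for \<open>A\<close> acting on columns of
  \<open>V\<close> also yields one for \<open>A\<^sup>T\<close> acting on columns of
  \<open>U\<close>.\<close>

lemma is_ESVD_transpose:
  assumes "sym_pos_def m M" "sym_pos_def n N" "is_ESVD m n M N A U S V"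
  shows "is_ESVD n m N M A\<^sup>T V S\<^sup>T U"
proof -
  have M: "M \<in> carrier_mat m m" "M\<^sup>T = M" and N: "N \<in> carrier_mat n n" "N\<^sup>T = N"
    using assms by (auto simp: sym_pos_def_def)
  have U: "U \<in> carrier_mat m m" and S: "S \<in> carrier_mat m n" and V: "V \<in> carrier_mat n n"
    and A: "A = M * U * S * V\<^sup>T * N" using assms by (auto simp: is_ESVD_def)
  have "A\<^sup>T = N\<^sup>T * (V * (S\<^sup>T * (U\<^sup>T * M\<^sup>T)))"
    unfolding A using M(1) N(1) U S V by (simp add: transpose_mult_dim)
  also have "\<dots> = N * V * S\<^sup>T * U\<^sup>T * M"
    unfolding M N using M(1) N(1) U S V by (simp add: assoc_mult_mat_dim)
  finally show ?thesis
    using assms(3) unfolding is_ESVD_def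
    by (auto simp: diagonal_mat_def min.commute)
qed

text \<open>For \<open>k \<le> m\<close>, right multiplication by this matrix selects the first
  \<open>k\<close> columns. Column selection thus becomes a matrix product, open to associativity
  and transposition.\<close>

definition trunc_id :: "nat \<Rightarrow> nat \<Rightarrow> 'a :: {zero,one} mat" where
  "trunc_id m k = mat m k (\<lambda>(i, j). if i = j then 1 else 0)"

lemma trunc_id_carrier [simp]: "trunc_id m k \<in> carrier_mat m k"
  by (simp add: trunc_id_def)

lemma col_trunc_id:
  assumes "k \<le> m" "j < k"
  shows "col (trunc_id m k) j = unit_vec m j"
  using assms by (intro eq_vecI) (auto simp: trunc_id_def unit_vec_def)

lemma first_cols_eq:
  assumes X: "X \<in> carrier_mat m m" and k: "k \<le> m"
  shows "first_cols k X = X * trunc_id m k"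
proof (rule eq_matI)
  fix i j assume "i < dim_row (X * trunc_id m k)" "j < dim_col (X * trunc_id m k)"
  then have ij: "i < m" "j < k" using X by (auto simp: trunc_id_def)
  have "first_cols k X $$ (i, j) = X $$ (i, j)"
    using X k ij by (auto simp: first_cols_def mat_of_cols_index)
  also have "\<dots> = (X * trunc_id m k) $$ (i, j)"
    using X k ij by (simp add: col_trunc_id trunc_id_carrier[THEN carrier_matD(1)]
        trunc_id_carrier[THEN carrier_matD(2)])
  finally show "first_cols k X $$ (i, j) = (X * trunc_id m k) $$ (i, j)" .
qed (use X k in \<open>auto simp: first_cols_def trunc_id_def\<close>)

lemma trunc_id_orthonormal:
  assumes "k \<le> m"
  shows "(trunc_id m k)\<^sup>T * trunc_id m k = (1\<^sub>m k :: 'a :: semiring_1 mat)"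
  using assms
  by (intro eq_matI) (auto simp: col_trunc_id trunc_id_carrier[THEN carrier_matD(1)]
      trunc_id_carrier[THEN carrier_matD(2)])

text \<open>The first \<open>k\<close> columns of a diagonal matrix vanish below row
  \<open>k\<close>, so they are its leading square block padded by zero rows.\<close>

lemma diagonal_mat_mult_trunc_id:
  fixes S :: "'a :: comm_semiring_1 mat"
  assumes S: "S \<in> carrier_mat m n" and "diagonal_mat S" and k: "k \<le> m" "k \<le> n"
  shows "S * trunc_id n k = trunc_id m k * mat k k (($$) S)"
proof (rule eq_matI)
  fix i j assume "i < dim_row (trunc_id m k * mat k k (($$) S))"
    "j < dim_col (trunc_id m k * mat k k (($$) S))"
  then have ij: "i < m" "j < k" by (auto simp: trunc_id_def)
  have "(S * trunc_id n k) $$ (i, j) = S $$ (i, j)"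
    using S k ij by (simp add: col_trunc_id trunc_id_carrier[THEN carrier_matD(1)]
        trunc_id_carrier[THEN carrier_matD(2)])
  moreover have "(trunc_id m k * mat k k (($$) S)) $$ (i, j) =
      (\<Sum>l = 0..<k. (if i = l then 1 else 0) * S $$ (l, j))"
    using ij by (auto simp: scalar_prod_def trunc_id_def intro!: sum.cong)
  moreover have "\<dots> = (\<Sum>l = 0..<k. if i = l then S $$ (l, j) else 0)"
    by (intro sum.cong) auto
  moreover have "\<dots> = (if i < k then S $$ (i, j) else 0)" by simp
  \<comment> \<open>Here \<open>j < k \<le> i\<close>, so the entry lies off the diagonal.\<close>
  moreover have "S $$ (i, j) = 0" if "\<not> i < k"
    using that assms ij by (auto simp: diagonal_mat_def)
  ultimately show "(S * trunc_id n k) $$ (i, j) = (trunc_id m k * mat k k (($$) S)) $$ (i, j)"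
    by simp
qed (use S in \<open>auto simp: trunc_id_def\<close>)

lemma first_cols_carrier:
  assumes "X \<in> carrier_mat m m" "k \<le> m"
  shows "first_cols k X \<in> carrier_mat m k"
  using assms by (auto simp: first_cols_def)

text \<open>With \<open>first_cols k U = U * J\<close> the product is
  \<open>J\<^sup>T * (U\<^sup>T * M * U) * J\<close>, which reduces to
  \<open>J\<^sup>T * J\<close>.\<close>

lemma first_cols_orthonormal:
  assumes M: "M \<in> carrier_mat m m" and U: "U \<in> carrier_mat m m" and k: "k \<le> m"
    and orth: "U\<^sup>T * M * U = 1\<^sub>m m"
  shows "(first_cols k U)\<^sup>T * (M * first_cols k U) = 1\<^sub>m k"
proof -
  define J where "J = (trunc_id m k :: real mat)"
  have J: "J \<in> carrier_mat m k" by (simp add: J_def)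
  have "(first_cols k U)\<^sup>T * (M * first_cols k U) = J\<^sup>T * U\<^sup>T * (M * (U * J))"
    using transpose_mult[OF U J] by (simp add: first_cols_eq[OF U k] J_def)
  also have "\<dots> = J\<^sup>T * (U\<^sup>T * M * U * J)"
    using M U J by (simp add: assoc_mult_mat_dim)
  also have "\<dots> = 1\<^sub>m k"
    using J trunc_id_orthonormal[OF k, where ?'a = real, folded J_def] by (simp add: orth)
  finally show ?thesis .
qed

text \<open>Orthonormality of \<open>V\<close> with respect to \<open>N\<close> cancels the right
  factors of the ESVD. The truncation then passes to the left of \<open>S\<close> because
  \<open>S\<close> is diagonal.\<close>

lemma ESVD_mult_first_cols:
  assumes M: "M \<in> carrier_mat m m" and N: "N \<in> carrier_mat n n"
    and esvd: "is_ESVD m n M N A U S V" and k: "k \<le> m" "k \<le> n"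
  shows "A * first_cols k V = M * first_cols k U * mat k k (($$) S)"
proof -
  have U: "U \<in> carrier_mat m m" and S: "S \<in> carrier_mat m n" and V: "V \<in> carrier_mat n n"
    and A: "A = M * U * S * V\<^sup>T * N" and orth: "V\<^sup>T * N * V = 1\<^sub>m n" and diag: "diagonal_mat S"
    using esvd by (auto simp: is_ESVD_def)
  define Jm Jn :: "real mat" where "Jm = trunc_id m k" and "Jn = trunc_id n k"
  have Jm: "Jm \<in> carrier_mat m k" and Jn: "Jn \<in> carrier_mat n k" by (simp_all add: Jm_def Jn_def)
  have "A * first_cols k V = M * (U * (S * ((V\<^sup>T * N * V) * Jn)))"
    unfolding A first_cols_eq[OF V k(2)] Jn_def[symmetric]
    using M N U S V Jn by (simp add: assoc_mult_mat_dim)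
  also have "\<dots> = M * (U * (Jm * mat k k (($$) S)))"
    unfolding orth using diagonal_mat_mult_trunc_id[OF S diag k, folded Jm_def Jn_def] Jn by simp
  also have "\<dots> = M * first_cols k U * mat k k (($$) S)"
    unfolding first_cols_eq[OF U k(1)] Jm_def[symmetric]
    using M U Jm by (simp add: assoc_mult_mat_dim)
  finally show ?thesis .
qed

lemma one_minus_four_block_diag:
  fixes B C :: "'a :: ring_1 mat"
  assumes "B \<in> carrier_mat m m" "C \<in> carrier_mat n n"
  shows "1\<^sub>m (m + n) - four_block_mat B (0\<^sub>m m n) (0\<^sub>m n m) C =
    four_block_mat (1\<^sub>m m - B) (0\<^sub>m m n) (0\<^sub>m n m) (1\<^sub>m n - C)"
  using assms by (intro eq_matI) auto


text \<open>Equality with a singleton expresses existence, uniqueness and the formula at once. The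
  invertibility conjunct ensures that \<open>inv_mat\<close> denotes a genuine inverse.\<close>

theorem theorem1:
  fixes m n k :: nat
    and M N A U S V :: "real mat"
    and b c ut :: "real vec"
  assumes "sym_pos_def m M"
    and "sym_pos_def n N"
    and "A \<in> carrier_mat m n" and "A \<noteq> 0\<^sub>m m n"
    and "b \<in> carrier_vec m" and "b \<noteq> 0\<^sub>v m"
    and "c \<in> carrier_vec n" and "c \<noteq> 0\<^sub>v n"
    and "is_ESVD m n M N A U S V"
    and "1 \<le> k" and "k \<le> min m n"
    and "ut \<in> carrier_vec (m + n)"
    and "(deflation_mat k M N U V * saddle_mat M N A) *\<^sub>v ut =
           deflation_mat k M N U V *\<^sub>v (b @\<^sub>v c)"
  shows "invertible_mat ((Z_mat k U V)\<^sup>T * saddle_mat M N A * Z_mat k U V) \<and>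
    {x @\<^sub>v y | x y. x \<in> carrier_vec m \<and> y \<in> carrier_vec n \<and>
             saddle_mat M N A *\<^sub>v (x @\<^sub>v y) = b @\<^sub>v c} =
         {(Z_mat k U V * inv_mat ((Z_mat k U V)\<^sup>T * saddle_mat M N A * Z_mat k U V)
              * (Z_mat k U V)\<^sup>T) *\<^sub>v (b @\<^sub>v c)
            + (deflation_mat k M N U V)\<^sup>T *\<^sub>v ut}"
proof -
  let ?K = "saddle_mat M N A" and ?Z = "Z_mat k U V" and ?D = "deflation_mat k M N U V"
  define Uk Vk T where "Uk = first_cols k U" and "Vk = first_cols k V" and "T = mat k k (($$) S)"
  define E where "E = saddle_mat (1\<^sub>m k) (1\<^sub>m k) T"
  define W where "W = four_block_mat (M * Uk) (0\<^sub>m m k) (0\<^sub>m n k) (N * Vk)"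
  note spd = assms(1,2) and esvd = assms(9)
  have M: "M \<in> carrier_mat m m" and N: "N \<in> carrier_mat n n" and A: "A \<in> carrier_mat m n"
    and Nt: "N\<^sup>T = N" using assms by (auto simp: sym_pos_def_def)
  have U: "U \<in> carrier_mat m m" and V: "V \<in> carrier_mat n n" and S: "S \<in> carrier_mat m n"
    and orth: "U\<^sup>T * M * U = 1\<^sub>m m" "V\<^sup>T * N * V = 1\<^sub>m n"
    using esvd by (auto simp: is_ESVD_def)
  have k: "k \<le> m" "k \<le> n" using assms(11) by auto
  have T: "T \<in> carrier_mat k k" by (simp add: T_def)
  have Uk: "Uk \<in> carrier_mat m k" and Vk: "Vk \<in> carrier_mat n k"
    using first_cols_carrier U V k by (auto simp: Uk_def Vk_def)
  have Z_eq: "?Z = four_block_mat Uk (0\<^sub>m m k) (0\<^sub>m n k) Vk"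
    using U V by (simp add: Z_mat_def Uk_def Vk_def)
  have Zt_eq: "?Z\<^sup>T = four_block_mat Uk\<^sup>T (0\<^sub>m k n) (0\<^sub>m k m) Vk\<^sup>T"
    unfolding Z_eq using transpose_four_block_mat[OF Uk _ _ Vk] by simp
  have Z: "?Z \<in> carrier_mat (m + n) (k + k)" unfolding Z_eq using Uk Vk by auto
  have W: "W \<in> carrier_mat (m + n) (k + k)" unfolding W_def using M N Uk Vk by auto
  have K: "?K \<in> carrier_mat (m + n) (m + n)" using saddle_mat_carrier M N .
  have E: "E \<in> carrier_mat (k + k) (k + k)" unfolding E_def by (simp add: saddle_mat_carrier)
  have Et: "E\<^sup>T = E" unfolding E_def using transpose_saddle_mat sym_pos_def_one T by blast
  have AV: "A * Vk = M * Uk * T"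
    using ESVD_mult_first_cols[OF M N esvd k] by (simp add: Uk_def Vk_def T_def)
  \<comment> \<open>The transposed ESVD has \<open>S\<^sup>T\<close> as its diagonal factor; its
    leading block is needed in terms of \<open>T\<close>.\<close>
  have "mat k k (($$) S\<^sup>T) = T\<^sup>T"
    using S k by (intro eq_matI) (auto simp: T_def)
  then have AU: "A\<^sup>T * Uk = N * Vk * T\<^sup>T"
    using ESVD_mult_first_cols[OF N M is_ESVD_transpose[OF spd esvd] k(2,1)]
    by (simp add: Uk_def Vk_def)
  \<comment> \<open>In the lower right block the sign sits on \<open>N\<close> in
    \<open>?K * ?Z\<close> but on the identity in \<open>W * E\<close>.\<close>
  have NV: "- N * Vk = - (N * Vk)" "N * Vk * - 1\<^sub>m k = - (N * Vk)" using N Vk by auto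
  have "?K * ?Z = four_block_mat (M * Uk) (A * Vk) (A\<^sup>T * Uk) (- N * Vk)"
    unfolding Z_eq saddle_mat_def
    by (subst mult_four_block_mat[OF M A _ _ Uk _ _ Vk]) (use M N A Uk Vk in auto)
  moreover have "W * E = four_block_mat (M * Uk) (M * Uk * T) (N * Vk * T\<^sup>T) (N * Vk * - 1\<^sub>m k)"
    unfolding W_def E_def saddle_mat_def
    by (subst mult_four_block_mat[of _ m k _ k _ n _ _ k _ k])
      (use M N T Uk Vk in auto)
  ultimately have KZ: "?K * ?Z = W * E" unfolding AV AU NV by simp
  have "Uk\<^sup>T * (M * Uk) = 1\<^sub>m k" "Vk\<^sup>T * (N * Vk) = 1\<^sub>m k"
    using first_cols_orthonormal M N U V k orth by (auto simp: Uk_def Vk_def)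
  then have "?Z\<^sup>T * W = four_block_mat (1\<^sub>m k) (0\<^sub>m k k) (0\<^sub>m k k) (1\<^sub>m k)"
    unfolding Zt_eq W_def
    by (subst mult_four_block_mat[of _ k m _ n _ k _ _ k _ k])
      (use M N Uk Vk in auto)
  then have ZW: "?Z\<^sup>T * W = 1\<^sub>m (k + k)" by simp
  have "?Z\<^sup>T * ?K * ?Z = ?Z\<^sup>T * (W * E)"
    using assoc_mult_mat[of "?Z\<^sup>T" "k + k" "m + n" ?K "m + n" ?Z "k + k"] Z K KZ by simp
  also have "\<dots> = ?Z\<^sup>T * W * E"
    using assoc_mult_mat[of "?Z\<^sup>T" "k + k" "m + n" W "k + k" E "k + k"] Z W E by simp
  finally have ZKZ: "?Z\<^sup>T * ?K * ?Z = E" using E by (simp add: ZW)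
  have "det E \<noteq> 0" unfolding E_def using saddle_mat_det_nonzero sym_pos_def_one T by blast
  note F = inv_mat_correct[OF E this]
  have "M * Uk * Uk\<^sup>T \<in> carrier_mat m m" "N * Vk * Vk\<^sup>T \<in> carrier_mat n n"
    using M N Uk Vk by auto
  note WZ_carrier = this
  have WZ: "W * ?Z\<^sup>T = four_block_mat (M * Uk * Uk\<^sup>T) (0\<^sub>m m n) (0\<^sub>m n m) (N * Vk * Vk\<^sup>T)"
    unfolding Zt_eq W_def
    by (subst mult_four_block_mat[of _ m k _ k _ n _ _ m _ n])
      (use M N Uk Vk in auto)
  \<comment> \<open>The deflation matrix contains the transpose of \<open>Q_mat\<close>; symmetry of
    \<open>N\<close> turns it into the form of the lower block of
    \<open>W * ?Z\<^sup>T\<close>.\<close>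
  have "(Vk * Vk\<^sup>T * N)\<^sup>T = N * Vk * Vk\<^sup>T"
    using N Nt Vk
    by (simp add: transpose_mult_dim assoc_mult_mat_dim)
  then have "(Q_mat k N V)\<^sup>T = 1\<^sub>m n - N * Vk * Vk\<^sup>T"
    unfolding Q_mat_def Vk_def[symmetric]
    using transpose_minus[of "1\<^sub>m n" n n "Vk * Vk\<^sup>T * N"] N Vk by simp
  then have D_eq: "?D = 1\<^sub>m (m + n) - W * ?Z\<^sup>T"
    unfolding deflation_mat_def P_mat_def WZ Uk_def[symmetric] one_minus_four_block_diag[OF WZ_carrier]
    using M N by simp
  note sol = deflated_solution[OF K transpose_saddle_mat[OF spd A] Z W E Et F(1,2) KZ D_eq
      append_carrier_vec[OF assms(5,7)] assms(12,13)]
  define u where "u = (?Z * inv_mat E * ?Z\<^sup>T) *\<^sub>v (b @\<^sub>v c) + ?D\<^sup>T *\<^sub>v ut"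
  have D: "?D \<in> carrier_mat (m + n) (m + n)"
    unfolding D_eq WZ
    by (intro minus_carrier_mat four_block_carrier_mat WZ_carrier)
  have u: "u \<in> carrier_vec (m + n)"
    unfolding u_def using D by (intro carrier_vecI) auto
  have Ku: "?K *\<^sub>v u = b @\<^sub>v c" using sol by (simp add: u_def)
  note G = inv_mat_correct[OF K saddle_mat_det_nonzero[OF spd A]]
  \<comment> \<open>Apply the left inverse of \<open>?K\<close> to
    \<open>?K *\<^sub>v v = ?K *\<^sub>v u\<close>.\<close>
  have uniq: "v = u" if "v \<in> carrier_vec (m + n)" "?K *\<^sub>v v = b @\<^sub>v c" for v
    using that u Ku G(1,3) K by (metis assoc_mult_mat_vec one_mult_mat_vec)
  have "{x @\<^sub>v y | x y. x \<in> carrier_vec m \<and> y \<in> carrier_vec n \<and> ?K *\<^sub>v (x @\<^sub>v y) = b @\<^sub>v c} = {u}"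
    (is "?L = _")
  proof
    show "?L \<subseteq> {u}" using uniq by auto
    \<comment> \<open>Splitting \<open>u\<close> after its first \<open>m\<close> entries supplies
      the witnesses \<open>x\<close> and \<open>y\<close>.\<close>
    have "u = vec_first u m @\<^sub>v vec_last u n" using u by simp
    then show "{u} \<subseteq> ?L"
      using Ku vec_first_carrier vec_last_carrier by (smt (verit) mem_Collect_eq singletonD subsetI)
  qed
  then show ?thesis using F(4) by (simp add: ZKZ u_def)
qed

end
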